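(* There is an absolute constant $C>0$ such that the following holds. Let $w$ be a positive integer, let $s$ be the largest integer with $1 - (1-2^{-w})^s \le 1/2$, and let $n = sw$. Let $A = \{x \in \{0,1\}^n : \mathrm{Tribes}_{w,s}(x) = 1\}$ and let $A^* \subseteq \{0,1\}^n$ be any superset of $A$ with $|A^*| = 2^{n-1}$. Identify $\{0,1\}^{n-1}$ with $\{x \in \{0,1\}^n : x_n = 0\}$. Then there exists a bijection $\phi \colon \{0,1\}^{n-1} \to A^*$ such that $\mathbb{E}_{x \in \{0,1\}^{n-1}}[\mathrm{dist}(x,\phi(x))] \le C\log n$ (with $x$ uniform in $\{0,1\}^{n-1}$), and in particular $\mathrm{avgstretch}(\phi) \le 2C\log n + 1$.
   Context: $\mathrm{Tribes}_{w,s} \colon \{0,1\}^{sw} \to \{0,1\}$ is $\bigvee_{i=1}^s (x_{(i-1)w+1} \wedge \dots \wedge x_{iw})$, i.e. the inputs are partitioned into $s$ consecutive blocks of size $w$ and the value is 1 iff some block is all ones. $\mathrm{dist}$ is the Hamming distance, and for a bijection $\phi \colon \{0,1\}^{n-1} \to A^*$, $\mathrm{avgstretch}(\phi) = \mathbb{E}[\mathrm{dist}(\phi(x),\phi(x'))]$ over a uniformly random pair $x,x' \in \{0,1\}^{n-1}$ differing in exactly one coordinate.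
   Formalization: The case n = 1 (that is, w = 1) is excluded by assuming n > 1: there s = 1, A* = {1}, the only bijection moves 0 to 1 at distance 1 > C log 1 = 0, and avgstretch averages over no pairs; for all w ≥ 2 one has n ≥ 2. *)

theory Defs
  imports "HOL-Probability.Probability_Mass_Function"
begin

definition cube :: "nat \<Rightarrow> bool list set" where
  "cube n = {x. length x = n}"

text \<open>Coordinates are numbered from 0, so block \<open>i < s\<close> occupies positions
  \<open>i * w, \<dots>, i * w + (w - 1)\<close>.\<close>

definition tribes :: "nat \<Rightarrow> nat \<Rightarrow> bool list \<Rightarrow> bool" where
  "tribes w s x \<longleftrightarrow> (\<exists>i<s. \<forall>j<w. x ! (i * w + j))"

text \<open>Only meaningful for lists of equal length.\<close>

definition hamming_dist :: "bool list \<Rightarrow> bool list \<Rightarrow> nat" where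
  "hamming_dist x y = card {i. i < length x \<and> x ! i \<noteq> y ! i}"

text \<open>The set of ordered pairs below is nonempty exactly if \<open>m \<ge> 1\<close>; for \<open>m = 0\<close> the
  average is unspecified.\<close>

definition avgstretch :: "nat \<Rightarrow> (bool list \<Rightarrow> bool list) \<Rightarrow> real" where
  "avgstretch m \<phi> =
     measure_pmf.expectation
       (pmf_of_set {(x, x'). x \<in> cube m \<and> x' \<in> cube m \<and> hamming_dist x x' = 1})
       (\<lambda>(x, x'). real (hamming_dist (\<phi> x) (\<phi> x')))"

definition tribes_threshold :: "nat \<Rightarrow> nat \<Rightarrow> bool" where
  "tribes_threshold w s \<longleftrightarrow>
     1 - (1 - 1 / 2 ^ w) ^ s \<le> (1 / 2 :: real) \<and>
     (\<forall>t. 1 - (1 - 1 / 2 ^ w) ^ t \<le> (1 / 2 :: real) \<longrightarrow> t \<le> s)"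

text \<open>The point \<open>x \<in> {0,1}\<^sup>n\<^sup>-\<^sup>1\<close> is identified with \<open>x @ [False] \<in> {0,1}\<^sup>n\<close>. For \<open>w = 1\<close> one gets
  \<open>s = n = 1\<close>, \<open>log n = 0\<close>, and the only bijection sends \<open>0\<close> to \<open>1\<close>, at distance 1; there are
  also no pairs to average over in the stretch. This degenerate case has to be excluded when
  bounding by a multiple of \<open>log n\<close>, by requiring \<open>n > 1\<close>.\<close>

end

theory Submission
  imports Defs
begin

text \<open>By Birkhoff's theorem it suffices to move half a unit of mass from every point of the cube so
  that every point of \<open>Astar\<close> receives one unit, at small total cost. Let \<open>D\<close> be the set of points
  without an all-ones block; it has density about one half. Picking a uniform point of \<open>D\<close> and
  setting each block independently to all ones with probability \<open>2\<^sup>-\<^sup>w\<close> gives a uniform point of the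
  cube, changing \<open>s / 2\<^sup>w \<le> 1\<close> blocks on average, so at an average cost of at most \<open>w = O(log n)\<close>.
  Restricted to targets outside \<open>D\<close> this transports mass from \<open>D\<close> evenly onto the tribes set. The
  set \<open>Astar - A\<close> has density \<open>O(2\<^sup>-\<^sup>w)\<close>, so even at the maximal distance \<open>n = s * w\<close> filling it
  costs only \<open>O(w)\<close> per point. Finally, merging the points \<open>x @ [False]\<close> and \<open>x @ [True]\<close> costs at
  most 1.\<close>

section \<open>Hall's marriage theorem\<close>

definition hall_condition :: "'a set \<Rightarrow> ('a \<Rightarrow> 'b set) \<Rightarrow> bool" where
  "hall_condition X N \<longleftrightarrow> (\<forall>S\<subseteq>X. card S \<le> card (\<Union>x\<in>S. N x))"

lemma hall_condition_violation:
  assumes "finite X" "hall_condition X N" "\<not> hall_condition X (N(a := B))"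
  obtains S where "S \<subseteq> X - {a}" "card ((\<Union>x\<in>S. N x) \<union> B) \<le> card S"
proof -
  obtain S where S: "S \<subseteq> X" "card (\<Union>x\<in>S. (N(a := B)) x) < card S"
    using assms(3) by (auto simp: hall_condition_def not_le)
  have "a \<in> S"
  proof (rule ccontr)
    assume "a \<notin> S"
    then have "(\<Union>x\<in>S. (N(a := B)) x) = (\<Union>x\<in>S. N x)" by auto
    then show False using S assms(2) by (auto simp: hall_condition_def not_le[symmetric])
  qed
  then have "(\<Union>x\<in>S. (N(a := B)) x) = (\<Union>x\<in>S - {a}. N x) \<union> B"
    by (auto split: if_splits)
  moreover have "card S = Suc (card (S - {a}))"
    using \<open>a \<in> S\<close> finite_subset[OF S(1) assms(1)] by (rule card.remove[rotated])
  ultimately show thesis using S by (intro that[of "S - {a}"]) auto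
qed

text \<open>Two violations, one for each removal, contradict each other by submodularity of
  \<open>S \<mapsto> card (\<Union>x\<in>S. N x)\<close>.\<close>

lemma hall_condition_remove:
  assumes "finite X" "\<And>x. x \<in> X \<Longrightarrow> finite (N x)" "hall_condition X N" "a \<in> X" "y \<noteq> z"
  shows "hall_condition X (N(a := N a - {y})) \<or> hall_condition X (N(a := N a - {z}))"
proof (rule ccontr)
  assume neg: "\<not> ?thesis"
  obtain S where S: "S \<subseteq> X - {a}" "card ((\<Union>x\<in>S. N x) \<union> (N a - {y})) \<le> card S"
    using hall_condition_violation[OF assms(1,3)] neg by blast
  obtain T where T: "T \<subseteq> X - {a}" "card ((\<Union>x\<in>T. N x) \<union> (N a - {z})) \<le> card T"
    using hall_condition_violation[OF assms(1,3)] neg by blast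
  define U where "U = (\<Union>x\<in>S. N x) \<union> (N a - {y})"
  define V where "V = (\<Union>x\<in>T. N x) \<union> (N a - {z})"
  have fin: "finite S" "finite T" "finite U" "finite V"
    using S(1) T(1) assms(1,2,4) finite_subset[of _ X]
    by (auto simp: U_def V_def subset_iff Diff_iff)
  have hall: "card R \<le> card (\<Union>x\<in>R. N x)" if "R \<subseteq> X" for R
    using assms(3) that by (simp add: hall_condition_def)
  have "Suc (card (S \<union> T)) = card (insert a (S \<union> T))"
    using S(1) T(1) fin by (subst card_insert_disjoint) auto
  also have "\<dots> \<le> card (\<Union>x\<in>insert a (S \<union> T). N x)"
    using S(1) T(1) assms(4) by (intro hall) auto
  also have "(\<Union>x\<in>insert a (S \<union> T). N x) = U \<union> V"
    using assms(5) by (auto simp: U_def V_def)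
  finally have "Suc (card (S \<union> T)) \<le> card (U \<union> V)" .
  moreover have "card (S \<inter> T) \<le> card (U \<inter> V)"
  proof -
    have "card (S \<inter> T) \<le> card (\<Union>x\<in>S \<inter> T. N x)" using S(1) by (intro hall) auto
    also have "\<dots> \<le> card (U \<inter> V)" using fin by (intro card_mono) (auto simp: U_def V_def)
    finally show ?thesis .
  qed
  ultimately have "Suc (card S + card T) \<le> card U + card V"
    using card_Un_Int[OF fin(1,2)] card_Un_Int[OF fin(3,4)] by linarith
  then show False using S(2) T(2) by (simp add: U_def V_def)
qed

lemma hall_condition_singletons:
  assumes "hall_condition X N"
    and unique: "\<And>x y z. x \<in> X \<Longrightarrow> y \<in> N x \<Longrightarrow> z \<in> N x \<Longrightarrow> y = z"
  shows "\<exists>f. inj_on f X \<and> (\<forall>x\<in>X. f x \<in> N x)"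
proof -
  have "N x \<noteq> {}" if "x \<in> X" for x
    using assms(1)[unfolded hall_condition_def, rule_format, of "{x}"] that by auto
  then have "\<forall>x\<in>X. \<exists>y. N x = {y}" using unique by blast
  then obtain f where f: "\<And>x. x \<in> X \<Longrightarrow> N x = {f x}" by metis
  have "inj_on f X"
  proof (rule inj_onI, rule ccontr)
    fix x y assume "x \<in> X" "y \<in> X" "f x = f y" "x \<noteq> y"
    then show False
      using assms(1)[unfolded hall_condition_def, rule_format, of "{x, y}"] f by auto
  qed
  then show ?thesis using f by blast
qed

theorem hall_marriage:
  assumes "finite X" "\<And>x. x \<in> X \<Longrightarrow> finite (N x)" "hall_condition X N"
  shows "\<exists>f. inj_on f X \<and> (\<forall>x\<in>X. f x \<in> N x)"
  using assms(2,3)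
proof (induction "\<Sum>x\<in>X. card (N x)" arbitrary: N rule: less_induct)
  case less
  show ?case
  proof (cases "\<exists>a\<in>X. \<exists>y\<in>N a. \<exists>z\<in>N a. y \<noteq> z")
    case True
    then obtain a v where a: "a \<in> X" and v: "v \<in> N a"
      and hall: "hall_condition X (N(a := N a - {v}))"
      using hall_condition_remove[OF assms(1) less.prems] by metis
    have "(\<Sum>x\<in>X. card ((N(a := N a - {v})) x)) < (\<Sum>x\<in>X. card (N x))"
      using assms(1) a v less.prems(1)
      by (intro sum_strict_mono_ex1)
        (auto intro!: bexI[of _ a] simp: card_Diff1_less card_mono simp del: card_Diff_insert)
    moreover have "finite ((N(a := N a - {v})) x)" if "x \<in> X" for x
      using less.prems(1)[OF that] less.prems(1)[OF a] by simp
    ultimately obtain f where f: "inj_on f X" "\<And>x. x \<in> X \<Longrightarrow> f x \<in> (N(a := N a - {v})) x"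
      using less.hyps[OF _ _ hall] by blast
    then have "f x \<in> N x" if "x \<in> X" for x using f(2)[OF that] by (auto split: if_splits)
    then show ?thesis using f(1) by blast
  next
    case False
    then show ?thesis by (intro hall_condition_singletons[OF less.prems(2)]) blast
  qed
qed

section \<open>Transport plans\<close>

definition transport_plan ::
    "'a set \<Rightarrow> ('a \<Rightarrow> real) \<Rightarrow> 'b set \<Rightarrow> ('b \<Rightarrow> real) \<Rightarrow> ('a \<Rightarrow> 'b \<Rightarrow> real) \<Rightarrow> bool" where
  "transport_plan X \<mu> Y \<nu> M \<longleftrightarrow> (\<forall>x\<in>X. \<forall>y\<in>Y. 0 \<le> M x y) \<and>
     (\<forall>x\<in>X. (\<Sum>y\<in>Y. M x y) = \<mu> x) \<and> (\<forall>y\<in>Y. (\<Sum>x\<in>X. M x y) = \<nu> y)"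

definition transport_cost ::
    "('a \<Rightarrow> 'b \<Rightarrow> real) \<Rightarrow> 'a set \<Rightarrow> 'b set \<Rightarrow> ('a \<Rightarrow> 'b \<Rightarrow> real) \<Rightarrow> real" where
  "transport_cost d X Y M = (\<Sum>x\<in>X. \<Sum>y\<in>Y. M x y * d x y)"

definition transport_within :: "('a \<Rightarrow> 'b \<Rightarrow> real) \<Rightarrow> real \<Rightarrow>
    'a set \<Rightarrow> ('a \<Rightarrow> real) \<Rightarrow> 'b set \<Rightarrow> ('b \<Rightarrow> real) \<Rightarrow> bool" where
  "transport_within d k X \<mu> Y \<nu> \<longleftrightarrow>
     (\<exists>M. transport_plan X \<mu> Y \<nu> M \<and> transport_cost d X Y M \<le> k)"

lemma transport_planI:
  assumes "\<And>x y. x \<in> X \<Longrightarrow> y \<in> Y \<Longrightarrow> 0 \<le> M x y"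
    and "\<And>x. x \<in> X \<Longrightarrow> (\<Sum>y\<in>Y. M x y) = \<mu> x"
    and "\<And>y. y \<in> Y \<Longrightarrow> (\<Sum>x\<in>X. M x y) = \<nu> y"
  shows "transport_plan X \<mu> Y \<nu> M"
  using assms by (simp add: transport_plan_def)

lemma transport_planD:
  assumes "transport_plan X \<mu> Y \<nu> M"
  shows "\<And>x y. x \<in> X \<Longrightarrow> y \<in> Y \<Longrightarrow> 0 \<le> M x y"
    and "\<And>x. x \<in> X \<Longrightarrow> (\<Sum>y\<in>Y. M x y) = \<mu> x"
    and "\<And>y. y \<in> Y \<Longrightarrow> (\<Sum>x\<in>X. M x y) = \<nu> y"
  using assms by (simp_all add: transport_plan_def)

lemma transport_withinI:
  "transport_plan X \<mu> Y \<nu> M \<Longrightarrow> transport_cost d X Y M \<le> k \<Longrightarrow> transport_within d k X \<mu> Y \<nu>"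
  by (auto simp: transport_within_def)

lemma transport_withinE:
  assumes "transport_within d k X \<mu> Y \<nu>"
  obtains M where "transport_plan X \<mu> Y \<nu> M" "transport_cost d X Y M \<le> k"
  using assms by (auto simp: transport_within_def)

lemma transport_within_cong:
  assumes "\<And>x. x \<in> X \<Longrightarrow> \<mu> x = \<mu>' x" "\<And>y. y \<in> Y \<Longrightarrow> \<nu> y = \<nu>' y"
  shows "transport_within d k X \<mu> Y \<nu> \<longleftrightarrow> transport_within d k X \<mu>' Y \<nu>'"
  using assms by (simp add: transport_within_def transport_plan_def)

lemma transport_plan_mass:
  assumes "transport_plan X \<mu> Y \<nu> M"
  shows "(\<Sum>x\<in>X. \<Sum>y\<in>Y. M x y) = sum \<mu> X" and "(\<Sum>x\<in>X. \<Sum>y\<in>Y. M x y) = sum \<nu> Y"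
proof -
  show "(\<Sum>x\<in>X. \<Sum>y\<in>Y. M x y) = sum \<mu> X"
    using transport_planD(2)[OF assms] by simp
  show "(\<Sum>x\<in>X. \<Sum>y\<in>Y. M x y) = sum \<nu> Y"
    using transport_planD(3)[OF assms] by (subst sum.swap) simp
qed

lemma transport_plan_remove_diagonal:
  assumes "finite Y" "X \<subseteq> Y" and M: "transport_plan X \<mu> Y \<nu> M"
    and diagonal: "\<And>x y. x \<in> X \<Longrightarrow> y \<in> X \<Longrightarrow> M x y = (if x = y then 1 else 0)"
  shows "transport_plan X (\<lambda>x. \<mu> x - 1) (Y - X) \<nu> M"
proof (rule transport_planI)
  show "(\<Sum>y\<in>Y - X. M x y) = \<mu> x - 1" if x: "x \<in> X" for x
  proof -
    have "(\<Sum>y\<in>X. M x y) = (\<Sum>y\<in>X. if x = y then 1 else 0)"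
      using diagonal[OF x] by (rule sum.cong[OF refl])
    then have "(\<Sum>y\<in>X. M x y) = 1" using x finite_subset[OF assms(2,1)] by simp
    then show ?thesis
      using sum.subset_diff[OF assms(2,1), of "M x"] transport_planD(2)[OF M x] by simp
  qed
qed (use transport_planD[OF M] in auto)

lemma transport_within_identity:
  assumes "finite X" "\<And>x. x \<in> X \<Longrightarrow> 0 \<le> \<mu> x" "\<And>x. x \<in> X \<Longrightarrow> d x x = 0"
  shows "transport_within d 0 X \<mu> X \<mu>"
proof (rule transport_withinI)
  let ?M = "\<lambda>x y. if x = y then \<mu> x else 0"
  show "transport_plan X \<mu> X \<mu> ?M" using assms by (intro transport_planI) auto
  have "?M x y * d x y = 0" if "x \<in> X" for x y
    using assms(3) that by (cases "x = y") auto
  then have "transport_cost d X X ?M = 0" unfolding transport_cost_def by (intro sum.neutral ballI)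
  then show "transport_cost d X X ?M \<le> 0" by simp
qed

lemma transport_within_uniform:
  fixes b :: real
  assumes "finite X" "X \<noteq> {}" "\<And>x y. x \<in> X \<Longrightarrow> y \<in> Y \<Longrightarrow> d x y \<le> b"
  shows "transport_within d (b * card Y) X (\<lambda>_. card Y / card X) Y (\<lambda>_. 1)"
proof (rule transport_withinI)
  let ?M = "\<lambda>_ _. 1 / real (card X)"
  show "transport_plan X (\<lambda>_. card Y / card X) Y (\<lambda>_. 1) ?M"
    using assms(1,2) by (intro transport_planI) auto
  have "transport_cost d X Y ?M \<le> (\<Sum>x\<in>X. \<Sum>y\<in>Y. b / card X)"
    unfolding transport_cost_def using assms(3) by (intro sum_mono) (auto intro: divide_right_mono)
  then show "transport_cost d X Y ?M \<le> b * card Y" using assms(1,2) by (simp add: mult.commute)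
qed

lemma transport_within_add:
  assumes "transport_within d k X \<mu> Y \<nu>" "transport_within d k' X \<mu>' Y \<nu>'"
  shows "transport_within d (k + k') X (\<lambda>x. \<mu> x + \<mu>' x) Y (\<lambda>y. \<nu> y + \<nu>' y)"
proof -
  obtain M where M: "transport_plan X \<mu> Y \<nu> M" "transport_cost d X Y M \<le> k"
    using assms(1) by (rule transport_withinE)
  obtain M' where M': "transport_plan X \<mu>' Y \<nu>' M'" "transport_cost d X Y M' \<le> k'"
    using assms(2) by (rule transport_withinE)
  show ?thesis
  proof (rule transport_withinI)
    show "transport_plan X (\<lambda>x. \<mu> x + \<mu>' x) Y (\<lambda>y. \<nu> y + \<nu>' y) (\<lambda>x y. M x y + M' x y)"
      using M(1) M'(1) by (simp add: transport_plan_def sum.distrib)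
    show "transport_cost d X Y (\<lambda>x y. M x y + M' x y) \<le> k + k'"
      using M(2) M'(2) by (simp add: transport_cost_def distrib_right sum.distrib)
  qed
qed

lemma transport_within_scale:
  assumes "transport_within d k X \<mu> Y \<nu>" "0 \<le> c"
  shows "transport_within d (c * k) X (\<lambda>x. c * \<mu> x) Y (\<lambda>y. c * \<nu> y)"
proof -
  obtain M where M: "transport_plan X \<mu> Y \<nu> M" "transport_cost d X Y M \<le> k"
    using assms(1) by (rule transport_withinE)
  show ?thesis
  proof (rule transport_withinI)
    show "transport_plan X (\<lambda>x. c * \<mu> x) Y (\<lambda>y. c * \<nu> y) (\<lambda>x y. c * M x y)"
      using M(1) assms(2) by (simp add: transport_plan_def flip: sum_distrib_left)
    have "transport_cost d X Y (\<lambda>x y. c * M x y) = c * transport_cost d X Y M"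
      by (simp add: transport_cost_def sum_distrib_left mult.assoc)
    then show "transport_cost d X Y (\<lambda>x y. c * M x y) \<le> c * k"
      using M(2) assms(2) by (simp add: mult_left_mono)
  qed
qed

lemma transport_within_extend:
  assumes "transport_within d k X \<mu> Y \<nu>" "X \<subseteq> X'" "Y \<subseteq> Y'" "finite X'" "finite Y'"
  shows "transport_within d k X' (\<lambda>x. if x \<in> X then \<mu> x else 0) Y' (\<lambda>y. if y \<in> Y then \<nu> y else 0)"
proof -
  obtain M where M: "transport_plan X \<mu> Y \<nu> M" "transport_cost d X Y M \<le> k"
    using assms(1) by (rule transport_withinE)
  define M' where "M' x y = (if x \<in> X then if y \<in> Y then M x y else 0 else 0)" for x y
  have sum_X: "(\<Sum>x\<in>X'. if x \<in> X then g x else 0) = (\<Sum>x\<in>X. g x)" for g :: "'a \<Rightarrow> real"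
    using assms(2,4) by (simp add: sum.If_cases Int_absorb1)
  have sum_Y: "(\<Sum>y\<in>Y'. if y \<in> Y then g y else 0) = (\<Sum>y\<in>Y. g y)" for g :: "'b \<Rightarrow> real"
    using assms(3,5) by (simp add: sum.If_cases Int_absorb1)
  show ?thesis
  proof (rule transport_withinI)
    show "transport_plan X' (\<lambda>x. if x \<in> X then \<mu> x else 0) Y' (\<lambda>y. if y \<in> Y then \<nu> y else 0) M'"
      using transport_planD[OF M(1)] by (intro transport_planI) (auto simp: M'_def sum_X sum_Y)
    have "M' x y * d x y = (if x \<in> X then if y \<in> Y then M x y * d x y else 0 else 0)" for x y
      by (simp add: M'_def)
    then have "transport_cost d X' Y' M'
        = (\<Sum>x\<in>X'. if x \<in> X then \<Sum>y\<in>Y. M x y * d x y else 0)"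
      unfolding transport_cost_def by (intro sum.cong refl) (simp add: sum_Y)
    then show "transport_cost d X' Y' M' \<le> k" using M(2) by (simp add: sum_X transport_cost_def)
  qed
qed

lemma transport_within_push_forward:
  assumes "transport_within d k X \<mu> Y \<nu>" "finite X" "finite X'" "h ` X \<subseteq> X'"
    and lipschitz: "\<And>x y. x \<in> X \<Longrightarrow> y \<in> Y \<Longrightarrow> d' (h x) y \<le> d x y + l"
  shows "transport_within d' (k + l * sum \<mu> X) X' (\<lambda>x'. \<Sum>x | x \<in> X \<and> h x = x'. \<mu> x) Y \<nu>"
proof -
  obtain M where M: "transport_plan X \<mu> Y \<nu> M" "transport_cost d X Y M \<le> k"
    using assms(1) by (rule transport_withinE)
  define M' where "M' x' y = (\<Sum>x | x \<in> X \<and> h x = x'. M x y)" for x' y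
  note regroup = sum.group[OF assms(2-4)]
  show ?thesis
  proof (rule transport_withinI)
    show "transport_plan X' (\<lambda>x'. \<Sum>x | x \<in> X \<and> h x = x'. \<mu> x) Y \<nu> M'"
    proof (rule transport_planI)
      show "(\<Sum>y\<in>Y. M' x' y) = (\<Sum>x | x \<in> X \<and> h x = x'. \<mu> x)" for x'
        unfolding M'_def using transport_planD(2)[OF M(1)] by (subst sum.swap) simp
    qed (use transport_planD[OF M(1)] in \<open>auto simp: M'_def regroup intro!: sum_nonneg\<close>)
    have "transport_cost d' X' Y M' = (\<Sum>x'\<in>X'. \<Sum>x | x \<in> X \<and> h x = x'. \<Sum>y\<in>Y. M x y * d' (h x) y)"
      unfolding transport_cost_def M'_def sum_distrib_right
      by (intro sum.cong refl trans[OF sum.swap]) auto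
    also have "\<dots> = (\<Sum>x\<in>X. \<Sum>y\<in>Y. M x y * d' (h x) y)" by (rule regroup)
    also have "\<dots> \<le> (\<Sum>x\<in>X. \<Sum>y\<in>Y. M x y * (d x y + l))"
      using transport_planD(1)[OF M(1)] lipschitz by (intro sum_mono mult_left_mono) auto
    also have "\<dots> = transport_cost d X Y M + l * sum \<mu> X"
      unfolding transport_plan_mass(1)[OF M(1), symmetric]
      by (simp add: transport_cost_def distrib_left sum.distrib sum_distrib_left mult.commute)
    finally show "transport_cost d' X' Y M' \<le> k + l * sum \<mu> X" using M(2) by linarith
  qed
qed

section \<open>Birkhoff's theorem\<close>

lemma transport_plan_support_hall:
  assumes "finite X" "finite Y" "c > 0" and M: "transport_plan X (\<lambda>_. c) Y (\<lambda>_. c) M"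
  shows "hall_condition X (\<lambda>x. {y \<in> Y. M x y > 0})"
  unfolding hall_condition_def
proof (intro allI impI)
  fix S assume S: "S \<subseteq> X"
  define U where "U = (\<Union>x\<in>S. {y \<in> Y. M x y > 0})"
  have U: "U \<subseteq> Y" by (auto simp: U_def)
  have "c * card S = (\<Sum>x\<in>S. \<Sum>y\<in>Y. M x y)"
    using transport_planD(2)[OF M] S by (simp add: subset_iff mult.commute)
  also have "\<dots> = (\<Sum>x\<in>S. \<Sum>y\<in>U. M x y)"
  proof (rule sum.cong[OF refl], rule sum.mono_neutral_right)
    show "\<forall>y\<in>Y - U. M x y = 0" if "x \<in> S" for x
      using transport_planD(1)[OF M, of x] that S by (force simp: U_def)
  qed (use U assms(2) in auto)
  also have "\<dots> = (\<Sum>y\<in>U. \<Sum>x\<in>S. M x y)" by (rule sum.swap)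
  also have "\<dots> \<le> (\<Sum>y\<in>U. \<Sum>x\<in>X. M x y)"
    using S U assms(1) transport_planD(1)[OF M] by (intro sum_mono sum_mono2) auto
  also have "\<dots> = c * card U"
    using transport_planD(3)[OF M] U by (simp add: subset_iff mult.commute)
  finally show "card S \<le> card (\<Union>x\<in>S. {y \<in> Y. M x y > 0})" using \<open>c > 0\<close> by (simp add: U_def)
qed

lemma transport_plan_support_bij:
  assumes "finite X" "finite Y" "c > 0" and M: "transport_plan X (\<lambda>_. c) Y (\<lambda>_. c) M"
  shows "\<exists>f. bij_betw f X Y \<and> (\<forall>x\<in>X. M x (f x) > 0)"
proof -
  obtain f where f: "inj_on f X" "\<And>x. x \<in> X \<Longrightarrow> f x \<in> Y \<and> M x (f x) > 0"
    using hall_marriage[OF assms(1) _ transport_plan_support_hall[OF assms]] assms(2) by auto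
  have "card X = card Y" using transport_plan_mass[OF M] \<open>c > 0\<close> by simp
  moreover have "f ` X \<subseteq> Y" using f(2) by auto
  ultimately have "f ` X = Y" using f(1) assms(2) by (simp add: card_image card_subset_eq)
  then show ?thesis using f by (auto simp: bij_betw_def)
qed

definition plan_support :: "'a set \<Rightarrow> 'b set \<Rightarrow> ('a \<Rightarrow> 'b \<Rightarrow> real) \<Rightarrow> ('a \<times> 'b) set" where
  "plan_support X Y M = {(x, y). x \<in> X \<and> y \<in> Y \<and> 0 < M x y}"

definition remove_matching :: "real \<Rightarrow> ('a \<Rightarrow> 'b) \<Rightarrow> ('a \<Rightarrow> 'b \<Rightarrow> real) \<Rightarrow> 'a \<Rightarrow> 'b \<Rightarrow> real" where
  "remove_matching m f M x y = M x y - (if y = f x then m else 0)"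

lemma transport_plan_remove_matching:
  assumes "finite X" "finite Y" "transport_plan X (\<lambda>_. c) Y (\<lambda>_. c) M" "bij_betw f X Y"
    and "\<And>x. x \<in> X \<Longrightarrow> m \<le> M x (f x)"
  shows "transport_plan X (\<lambda>_. c - m) Y (\<lambda>_. c - m) (remove_matching m f M)"
proof (rule transport_planI)
  show "0 \<le> remove_matching m f M x y" if "x \<in> X" "y \<in> Y" for x y
    using that assms(5) transport_planD(1)[OF assms(3)] by (simp add: remove_matching_def)
  show "(\<Sum>y\<in>Y. remove_matching m f M x y) = c - m" if "x \<in> X" for x
    using that bij_betwE[OF assms(4)] assms(2) transport_planD(2)[OF assms(3)]
    by (simp add: remove_matching_def sum_subtractf)
  show "(\<Sum>x\<in>X. remove_matching m f M x y) = c - m" if y: "y \<in> Y" for y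
  proof -
    have "(\<Sum>x\<in>X. if y = f x then m else 0) = (\<Sum>z\<in>Y. if y = z then m else 0)"
      by (rule sum.reindex_bij_betw[OF assms(4)])
    then show ?thesis
      using y assms(2) transport_planD(3)[OF assms(3)]
      by (simp add: remove_matching_def sum_subtractf)
  qed
qed

lemma transport_cost_remove_matching:
  assumes "finite Y" "bij_betw f X Y"
  shows "transport_cost d X Y (remove_matching m f M)
    = transport_cost d X Y M - m * (\<Sum>x\<in>X. d x (f x))"
proof -
  have "(\<Sum>y\<in>Y. remove_matching m f M x y * d x y) = (\<Sum>y\<in>Y. M x y * d x y) - m * d x (f x)"
    if "x \<in> X" for x
  proof -
    have "(\<Sum>y\<in>Y. remove_matching m f M x y * d x y)
        = (\<Sum>y\<in>Y. M x y * d x y - (if y = f x then m * d x (f x) else 0))"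
      by (intro sum.cong) (auto simp: remove_matching_def algebra_simps)
    then show ?thesis using bij_betwE[OF assms(2)] that assms(1) by (simp add: sum_subtractf)
  qed
  then show ?thesis by (simp add: transport_cost_def sum_subtractf sum_distrib_left)
qed

lemma saturating_matching:
  assumes "finite X" "finite Y" "c > 0" "X \<noteq> {}" and M: "transport_plan X (\<lambda>_. c) Y (\<lambda>_. c) M"
  obtains f m where "bij_betw f X Y" "0 < m" "m \<le> c" "\<And>x. x \<in> X \<Longrightarrow> m \<le> M x (f x)"
    and "plan_support X Y (remove_matching m f M) \<subset> plan_support X Y M"
proof -
  obtain f where f: "bij_betw f X Y" "\<And>x. x \<in> X \<Longrightarrow> M x (f x) > 0"
    using transport_plan_support_bij[OF assms(1-3) M] by blast
  define m where "m = (MIN x\<in>X. M x (f x))"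
  have m_le: "m \<le> M x (f x)" if "x \<in> X" for x using assms(1) that by (auto simp: m_def)
  have "m \<in> (\<lambda>x. M x (f x)) ` X" unfolding m_def using assms(1,4) by (intro Min_in) auto
  then obtain a where a: "a \<in> X" "m = M a (f a)" by blast
  have fa: "f a \<in> Y" using bij_betwE[OF f(1)] a(1) by blast
  have "m \<le> c"
    using member_le_sum[of "f a" Y "M a"] a fa assms(2) transport_planD(1,2)[OF M] by auto
  moreover have "0 < m" using a f(2) by simp
  moreover have "plan_support X Y (remove_matching m f M) \<subset> plan_support X Y M"
  proof (rule psubsetI)
    show "plan_support X Y (remove_matching m f M) \<subseteq> plan_support X Y M"
      using \<open>0 < m\<close> by (auto simp: plan_support_def remove_matching_def split: if_splits)
    have "(a, f a) \<in> plan_support X Y M - plan_support X Y (remove_matching m f M)"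
      using a fa \<open>0 < m\<close> by (simp add: plan_support_def remove_matching_def)
    then show "plan_support X Y (remove_matching m f M) \<noteq> plan_support X Y M" by blast
  qed
  ultimately show thesis using that f(1) m_le by blast
qed

lemma transport_cost_gt_bij:
  assumes "finite X" "finite Y" "c > 0" "transport_plan X (\<lambda>_. c) Y (\<lambda>_. c) M"
    and gt: "\<And>f. bij_betw f X Y \<Longrightarrow> K < (\<Sum>x\<in>X. d x (f x))"
  shows "c * K < transport_cost d X Y M"
  using assms(3,4)
proof (induction "card (plan_support X Y M)" arbitrary: M c rule: less_induct)
  case less
  show ?case
  proof (cases "X = {}")
    case True
    obtain f where "bij_betw f X Y"
      using transport_plan_support_bij[OF assms(1,2) less.prems] by blast
    then show ?thesis using gt True less.prems(1) by (simp add: transport_cost_def mult_pos_neg)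
  next
    case False
    obtain f m where f: "bij_betw f X Y" and m: "0 < m" "m \<le> c" "\<And>x. x \<in> X \<Longrightarrow> m \<le> M x (f x)"
      and support: "plan_support X Y (remove_matching m f M) \<subset> plan_support X Y M"
      by (rule saturating_matching[OF assms(1,2) less.prems(1) False less.prems(2)]) blast
    let ?R = "remove_matching m f M"
    note R = transport_plan_remove_matching[OF assms(1,2) less.prems(2) f m(3)]
    have "(c - m) * K \<le> transport_cost d X Y ?R"
    proof (cases "m = c")
      case True
      have "?R x y = 0" if "x \<in> X" "y \<in> Y" for x y
        using transport_planD(1,2)[OF R] that assms(2) True by (simp add: sum_nonneg_eq_0_iff)
      then show ?thesis using True by (simp add: transport_cost_def)
    next
      case False
      have "plan_support X Y M \<subseteq> X \<times> Y" by (auto simp: plan_support_def)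
      then have "finite (plan_support X Y M)" by (rule finite_subset) (simp add: assms(1,2))
      then have "card (plan_support X Y ?R) < card (plan_support X Y M)"
        using support by (rule psubset_card_mono)
      then show ?thesis using less.hyps[OF _ _ R] m(2) False by simp
    qed
    moreover have "m * K < m * (\<Sum>x\<in>X. d x (f x))" using gt[OF f] m(1) by simp
    ultimately show ?thesis
      using transport_cost_remove_matching[OF assms(2) f, of d m M] by (simp add: left_diff_distrib)
  qed
qed

theorem transport_within_imp_bij:
  assumes "finite X" "finite Y" "c > 0" "transport_within d k X (\<lambda>_. c) Y (\<lambda>_. c)"
  shows "\<exists>f. bij_betw f X Y \<and> c * (\<Sum>x\<in>X. d x (f x)) \<le> k"
proof (rule ccontr)
  assume "\<not> ?thesis"
  then have "k / c < (\<Sum>x\<in>X. d x (f x))" if "bij_betw f X Y" for f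
    using that \<open>c > 0\<close> by (auto simp: not_le pos_divide_less_eq mult.commute)
  moreover obtain M where "transport_plan X (\<lambda>_. c) Y (\<lambda>_. c) M" "transport_cost d X Y M \<le> k"
    using assms(4) by (rule transport_withinE)
  ultimately show False
    using transport_cost_gt_bij[OF assms(1-3), of M "k / c" d] \<open>c > 0\<close> by simp
qed

section \<open>The Hamming cube\<close>

abbreviation hamming_cost :: "bool list \<Rightarrow> bool list \<Rightarrow> real" where
  "hamming_cost x y \<equiv> real (hamming_dist x y)"

lemma hamming_dist_conv_filter:
  assumes "length x = length y"
  shows "hamming_dist x y = length (filter (\<lambda>(a, b). a \<noteq> b) (zip x y))"
  unfolding hamming_dist_def length_filter_conv_card using assms
  by (intro arg_cong[where f = card]) auto

lemma hamming_dist_append: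
  assumes "length u = length u'" "length v = length v'"
  shows "hamming_dist (u @ v) (u' @ v') = hamming_dist u u' + hamming_dist v v'"
  using assms by (simp add: hamming_dist_conv_filter)

lemma hamming_dist_refl [simp]: "hamming_dist x x = 0"
  by (simp add: hamming_dist_def)

lemma hamming_dist_le_length: "hamming_dist x y \<le> length x"
  using card_mono[of "{..<length x}" "{i. i < length x \<and> x ! i \<noteq> y ! i}"]
  by (auto simp: hamming_dist_def)

lemma hamming_dist_commute: "length x = length y \<Longrightarrow> hamming_dist x y = hamming_dist y x"
  unfolding hamming_dist_def by (intro arg_cong[where f = card]) auto

lemma hamming_dist_triangle:
  assumes "length x = length y"
  shows "hamming_dist x z \<le> hamming_dist x y + hamming_dist y z"
proof -
  have "hamming_dist x z
      \<le> card ({i. i < length x \<and> x ! i \<noteq> y ! i} \<union> {i. i < length y \<and> y ! i \<noteq> z ! i})"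
    unfolding hamming_dist_def using assms by (intro card_mono) auto
  also have "\<dots> \<le> hamming_dist x y + hamming_dist y z"
    unfolding hamming_dist_def by (rule card_Un_le)
  finally show ?thesis .
qed

lemma cubeD: "x \<in> cube n \<Longrightarrow> length x = n"
  by (simp add: cube_def)

lemma finite_cube [simp]: "finite (cube n)"
  using finite_lists_length_eq[of "UNIV :: bool set" n] by (simp add: cube_def)

lemma card_cube: "card (cube n) = 2 ^ n"
  using card_lists_length_eq[of "UNIV :: bool set" n] by (simp add: cube_def)

lemma cube_nonempty [simp]: "cube n \<noteq> {}"
  using card_cube[of n] by auto

lemma cube_0 [simp]: "cube 0 = {[]}"
  by (auto simp: cube_def)

lemma transport_within_uniform_cube:
  assumes "X \<subseteq> cube n" "X \<noteq> {}"
  shows "transport_within hamming_cost (real n * card Y) X (\<lambda>_. card Y / card X) Y (\<lambda>_. 1)"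
proof (rule transport_within_uniform)
  show "finite X" using assms(1) by (rule finite_subset) simp
  show "hamming_cost x y \<le> n" if "x \<in> X" for x y
    using hamming_dist_le_length[of x y] that assms(1) by (auto simp: cube_def)
qed (rule assms(2))

lemma butlast_fibre_cube:
  assumes "x' \<in> cube m"
  shows "{x. x \<in> cube (Suc m) \<and> butlast x = x'} = {x' @ [False], x' @ [True]}"
proof (intro subset_antisym subsetI)
  fix x assume x: "x \<in> {x. x \<in> cube (Suc m) \<and> butlast x = x'}"
  then have "x \<noteq> []" by (auto simp: cube_def)
  then have "x = x' @ [last x]" using x append_butlast_last_id[of x] by simp
  then show "x \<in> {x' @ [False], x' @ [True]}" by (cases "last x") auto
qed (use assms in \<open>auto simp: cube_def\<close>)

lemma transport_within_merge_last:
  assumes "transport_within hamming_cost k (cube (Suc m)) (\<lambda>_. 1 / 2) Y \<nu>"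
  shows "transport_within (\<lambda>x. hamming_cost (x @ [False])) (k + 2 ^ m) (cube m) (\<lambda>_. 1) Y \<nu>"
proof -
  have "hamming_cost (butlast x @ [False]) y \<le> hamming_cost x y + 1"
    if x: "x \<in> cube (Suc m)" for x y
  proof -
    have "x \<noteq> []" using x by (auto simp: cube_def)
    then have "hamming_dist (butlast x @ [False]) x
        = hamming_dist (butlast x @ [False]) (butlast x @ [last x])" by simp
    also have "\<dots> \<le> 1"
      using hamming_dist_le_length[of "[False]" "[last x]"] by (simp add: hamming_dist_append)
    finally show ?thesis
      using hamming_dist_triangle[of "butlast x @ [False]" x y] x by (simp add: cube_def)
  qed
  then have "transport_within (\<lambda>x. hamming_cost (x @ [False])) (k + 1 * (\<Sum>x\<in>cube (Suc m). 1 / 2))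
      (cube m) (\<lambda>x'. \<Sum>x | x \<in> cube (Suc m) \<and> butlast x = x'. 1 / 2) Y \<nu>"
    by (intro transport_within_push_forward[OF assms] finite_cube) (auto simp: cube_def)
  moreover have "(\<Sum>x | x \<in> cube (Suc m) \<and> butlast x = x'. 1 / 2 :: real) = 1"
    if "x' \<in> cube m" for x'
    unfolding butlast_fibre_cube[OF that] by simp
  moreover have "1 * (\<Sum>x\<in>cube (Suc m). 1 / 2 :: real) = 2 ^ m" by (simp add: card_cube)
  ultimately show ?thesis by (metis (no_types, lifting) transport_within_cong)
qed

definition conc :: "'a list set \<Rightarrow> 'a list set \<Rightarrow> 'a list set" (infixr "@@" 75) where
  "U @@ V = (\<lambda>(u, v). u @ v) ` (U \<times> V)"

lemma concI: "u \<in> U \<Longrightarrow> v \<in> V \<Longrightarrow> u @ v \<in> U @@ V"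
  by (auto simp: conc_def)

lemma concE:
  assumes "x \<in> U @@ V"
  obtains u v where "x = u @ v" "u \<in> U" "v \<in> V"
  using assms by (auto simp: conc_def)

lemma sum_conc:
  assumes "\<And>u. u \<in> U \<Longrightarrow> length u = a"
  shows "sum f (U @@ V) = (\<Sum>u\<in>U. \<Sum>v\<in>V. f (u @ v))"
proof -
  have "inj_on (\<lambda>(u, v). u @ v) (U \<times> V)" using assms by (auto simp: inj_on_def)
  then show ?thesis by (simp add: conc_def sum.reindex sum.cartesian_product case_prod_unfold)
qed

lemma card_conc:
  assumes "\<And>u. u \<in> U \<Longrightarrow> length u = a"
  shows "card (U @@ V) = card U * card V"
  using sum_conc[OF assms, of U "\<lambda>_. 1 :: nat" V] by simp

lemma cube_add: "cube (a + b) = cube a @@ cube b"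
proof (intro subset_antisym subsetI)
  fix x assume "x \<in> cube (a + b)"
  then have "take a x @ drop a x \<in> cube a @@ cube b" by (intro concI) (auto simp: cube_def)
  then show "x \<in> cube a @@ cube b" by simp
qed (auto simp: cube_def elim!: concE)

definition conc_plan :: "nat \<Rightarrow> ('a list \<Rightarrow> 'b list \<Rightarrow> real) \<Rightarrow> ('a list \<Rightarrow> 'b list \<Rightarrow> real)
    \<Rightarrow> 'a list \<Rightarrow> 'b list \<Rightarrow> real" where
  "conc_plan a K L x y = K (take a x) (take a y) * L (drop a x) (drop a y)"

lemma conc_plan_append:
  "length u = a \<Longrightarrow> length u' = a \<Longrightarrow> conc_plan a K L (u @ v) (u' @ v') = K u u' * L v v'"
  by (simp add: conc_plan_def)

lemma transport_plan_conc:
  assumes "\<And>u. u \<in> U \<Longrightarrow> length u = a" "\<And>u'. u' \<in> U' \<Longrightarrow> length u' = a"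
    and K: "transport_plan U (\<lambda>_. r) U' (\<lambda>_. c) K" and L: "transport_plan V (\<lambda>_. r') V' (\<lambda>_. c') L"
  shows "transport_plan (U @@ V) (\<lambda>_. r * r') (U' @@ V') (\<lambda>_. c * c') (conc_plan a K L)"
proof (rule transport_planI)
  show "0 \<le> conc_plan a K L x y" if "x \<in> U @@ V" "y \<in> U' @@ V'" for x y
    using that assms(1,2) transport_planD(1)[OF K] transport_planD(1)[OF L]
    by (auto simp: conc_plan_append elim!: concE)
  show "(\<Sum>y\<in>U' @@ V'. conc_plan a K L x y) = r * r'" if "x \<in> U @@ V" for x
    using that assms(1,2) transport_planD(2)[OF K] transport_planD(2)[OF L]
    by (auto simp: sum_conc[of U' a] conc_plan_append elim!: concE simp flip: sum_product)
  show "(\<Sum>x\<in>U @@ V. conc_plan a K L x y) = c * c'" if "y \<in> U' @@ V'" for y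
    using that assms(1,2) transport_planD(3)[OF K] transport_planD(3)[OF L]
    by (auto simp: sum_conc[of U a] conc_plan_append elim!: concE simp flip: sum_product)
qed

lemma transport_cost_conc:
  assumes "\<And>u. u \<in> U \<Longrightarrow> length u = a" "\<And>u'. u' \<in> U' \<Longrightarrow> length u' = a"
    and K: "transport_plan U (\<lambda>_. r) U' (\<lambda>_. c) K" and L: "transport_plan V (\<lambda>_. r') V' (\<lambda>_. c') L"
    and additive: "\<And>u u' v v'. u \<in> U \<Longrightarrow> u' \<in> U' \<Longrightarrow> v \<in> V \<Longrightarrow> v' \<in> V'
      \<Longrightarrow> d (u @ v) (u' @ v') = d u u' + d v v'"
  shows "transport_cost d (U @@ V) (U' @@ V') (conc_plan a K L)
    = transport_cost d U U' K * (c' * card V') + (c * card U') * transport_cost d V V' L"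
proof -
  have "conc_plan a K L (u @ v) (u' @ v') * d (u @ v) (u' @ v')
      = (K u u' * d u u') * L v v' + K u u' * (L v v' * d v v')"
    if "u \<in> U" "u' \<in> U'" "v \<in> V" "v' \<in> V'" for u u' v v'
    using that by (simp add: conc_plan_append assms(1,2) additive algebra_simps)
  then have "transport_cost d (U @@ V) (U' @@ V') (conc_plan a K L)
      = (\<Sum>u\<in>U. \<Sum>v\<in>V. \<Sum>u'\<in>U'. \<Sum>v'\<in>V'. (K u u' * d u u') * L v v' + K u u' * (L v v' * d v v'))"
    by (simp add: transport_cost_def sum_conc[OF assms(1)] sum_conc[OF assms(2)])
  also have "\<dots> = transport_cost d U U' K * (\<Sum>v\<in>V. \<Sum>v'\<in>V'. L v v')
      + (\<Sum>u\<in>U. \<Sum>u'\<in>U'. K u u') * transport_cost d V V' L"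
    by (simp add: transport_cost_def sum.distrib flip: sum_product)
  finally show ?thesis
    unfolding transport_plan_mass(2)[OF K] transport_plan_mass(2)[OF L] by (simp add: mult.commute)
qed

section \<open>Average stretch\<close>

definition adjacent_pairs :: "nat \<Rightarrow> (bool list \<times> bool list) set" where
  "adjacent_pairs m = {(x, x'). x \<in> cube m \<and> x' \<in> cube m \<and> hamming_dist x x' = 1}"

definition mean_dist :: "nat \<Rightarrow> (bool list \<Rightarrow> bool list) \<Rightarrow> (bool list \<Rightarrow> bool list) \<Rightarrow> real" where
  "mean_dist m \<phi> \<psi> =
     measure_pmf.expectation (pmf_of_set (cube m)) (\<lambda>x. hamming_cost (\<phi> x) (\<psi> x))"

lemma mean_dist_eq_sum: "mean_dist m \<phi> \<psi> = (\<Sum>x\<in>cube m. hamming_cost (\<phi> x) (\<psi> x)) / 2 ^ m"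
  by (simp add: mean_dist_def integral_pmf_of_set card_cube)

lemma avgstretch_eq_expectation:
  "avgstretch m \<phi> = measure_pmf.expectation (pmf_of_set (adjacent_pairs m))
     (\<lambda>(x, x'). hamming_cost (\<phi> x) (\<phi> x'))"
  by (simp add: avgstretch_def adjacent_pairs_def)

lemma finite_adjacent_pairs [simp]: "finite (adjacent_pairs m)"
  by (rule finite_subset[of _ "cube m \<times> cube m"]) (auto simp: adjacent_pairs_def)

lemma hamming_dist_eq_1_iff:
  assumes "length x = length y"
  shows "hamming_dist x y = 1 \<longleftrightarrow> (\<exists>i<length x. y = x[i := \<not> x ! i])"
proof
  assume "hamming_dist x y = 1"
  then obtain i where i: "{i. i < length x \<and> x ! i \<noteq> y ! i} = {i}"
    by (auto simp: hamming_dist_def card_1_singleton_iff)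
  have "y = x[i := \<not> x ! i]"
  proof (rule nth_equalityI)
    fix j assume "j < length y"
    moreover from this have "x ! j \<noteq> y ! j \<longleftrightarrow> j = i" using i assms by auto
    ultimately show "y ! j = x[i := \<not> x ! i] ! j" using assms by (auto simp: nth_list_update)
  qed (simp add: assms)
  then show "\<exists>i<length x. y = x[i := \<not> x ! i]" using i by blast
next
  assume "\<exists>i<length x. y = x[i := \<not> x ! i]"
  then obtain i where i: "i < length x" "y = x[i := \<not> x ! i]" by blast
  then have "{j. j < length x \<and> x ! j \<noteq> y ! j} = {i}" by (auto simp: nth_list_update)
  then show "hamming_dist x y = 1" by (simp add: hamming_dist_def)
qed

lemma card_neighbours_cube:
  assumes "x \<in> cube m"
  shows "card {y \<in> cube m. hamming_dist x y = 1} = m"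
proof -
  have "{y \<in> cube m. hamming_dist x y = 1} = (\<lambda>i. x[i := \<not> x ! i]) ` {..<m}"
    using assms by (auto simp: cube_def hamming_dist_eq_1_iff simp del: One_nat_def)
  moreover have "inj_on (\<lambda>i. x[i := \<not> x ! i]) {..<m}"
  proof (rule inj_onI)
    fix i j assume "i \<in> {..<m}" and eq: "x[i := \<not> x ! i] = x[j := \<not> x ! j]"
    then have "x[j := \<not> x ! j] ! i = (\<not> x ! i)"
      using assms by (simp add: cube_def flip: eq)
    then show "i = j" by (cases "i = j") auto
  qed
  ultimately show ?thesis by (simp add: card_image)
qed

lemma sum_adjacent_pairs_fst:
  fixes g :: "bool list \<Rightarrow> real"
  shows "(\<Sum>(x, x')\<in>adjacent_pairs m. g x) = m * (\<Sum>x\<in>cube m. g x)"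
proof -
  have "adjacent_pairs m = Sigma (cube m) (\<lambda>x. {y \<in> cube m. hamming_dist x y = 1})"
    by (auto simp: adjacent_pairs_def)
  then show ?thesis
    by (simp add: sum.Sigma[symmetric] card_neighbours_cube sum_distrib_left del: One_nat_def)
qed

lemma card_adjacent_pairs: "real (card (adjacent_pairs m)) = m * 2 ^ m"
  using sum_adjacent_pairs_fst[of "\<lambda>_. 1" m] by (simp add: card_cube)

lemma adjacent_pairs_nonempty: "m > 0 \<Longrightarrow> adjacent_pairs m \<noteq> {}"
  using card_adjacent_pairs[of m] by auto

lemma expectation_adjacent_pairs_fst:
  fixes g :: "bool list \<Rightarrow> real"
  assumes "m > 0"
  shows "measure_pmf.expectation (pmf_of_set (adjacent_pairs m)) (\<lambda>(x, x'). g x)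
    = measure_pmf.expectation (pmf_of_set (cube m)) g"
  using assms
  by (simp add: integral_pmf_of_set adjacent_pairs_nonempty sum_adjacent_pairs_fst
    card_adjacent_pairs card_cube)

lemma expectation_adjacent_pairs_snd:
  fixes g :: "bool list \<Rightarrow> real"
  assumes "m > 0"
  shows "measure_pmf.expectation (pmf_of_set (adjacent_pairs m)) (\<lambda>(x, x'). g x')
    = measure_pmf.expectation (pmf_of_set (cube m)) g"
proof -
  have "(\<Sum>(x, x')\<in>adjacent_pairs m. g x') = (\<Sum>(x, x')\<in>adjacent_pairs m. g x)"
    by (rule sum.reindex_bij_witness[of _ prod.swap prod.swap])
      (auto simp: adjacent_pairs_def cube_def hamming_dist_commute)
  then show ?thesis
    using expectation_adjacent_pairs_fst[OF assms, of g] assms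
    by (simp add: integral_pmf_of_set adjacent_pairs_nonempty)
qed

lemma hamming_dist_quadrangle:
  assumes "length a = n" "length b = n" "length a' = n" "length b' = n"
  shows "hamming_dist a' b' \<le> hamming_dist a b + (hamming_dist a a' + hamming_dist b b')"
  using hamming_dist_triangle[of a' a b'] hamming_dist_triangle[of a b b']
    hamming_dist_commute[of a a'] assms by simp

lemma avgstretch_perturb:
  assumes "m > 0" "\<phi> \<in> cube m \<rightarrow> cube n" "\<psi> \<in> cube m \<rightarrow> cube n"
  shows "avgstretch m \<psi> \<le> avgstretch m \<phi> + 2 * mean_dist m \<phi> \<psi>"
proof -
  define P where "P = pmf_of_set (adjacent_pairs m)"
  let ?g = "\<lambda>x. hamming_cost (\<phi> x) (\<psi> x)"
  have set_P: "set_pmf P = adjacent_pairs m"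
    using assms(1) by (simp add: P_def adjacent_pairs_nonempty)
  have integrable [simp]: "integrable (measure_pmf P) f" for f :: "bool list \<times> bool list \<Rightarrow> real"
    by (rule integrable_measure_pmf_finite) (simp add: set_P)
  let ?stretch = "\<lambda>\<eta> (x, x'). hamming_cost (\<eta> x) (\<eta> x')"
  have "hamming_dist (\<psi> x) (\<psi> x')
      \<le> hamming_dist (\<phi> x) (\<phi> x') + (hamming_dist (\<phi> x) (\<psi> x) + hamming_dist (\<phi> x') (\<psi> x'))"
    if "(x, x') \<in> adjacent_pairs m" for x x'
    using that assms(2,3)
    by (intro hamming_dist_quadrangle[of _ n]) (auto simp: adjacent_pairs_def cube_def)
  then have stretch_le: "AE p in P. ?stretch \<psi> p
      \<le> ?stretch \<phi> p + ((case p of (x, x') \<Rightarrow> ?g x) + (case p of (x, x') \<Rightarrow> ?g x'))"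
    by (auto simp: AE_measure_pmf_iff set_P simp flip: of_nat_add of_nat_le_iff)
  have "avgstretch m \<psi> = measure_pmf.expectation P (?stretch \<psi>)"
    by (simp add: avgstretch_eq_expectation P_def)
  also have "\<dots> \<le> measure_pmf.expectation P
      (\<lambda>p. ?stretch \<phi> p + ((case p of (x, x') \<Rightarrow> ?g x) + (case p of (x, x') \<Rightarrow> ?g x')))"
    by (rule integral_mono_AE[OF integrable integrable stretch_le])
  also have "\<dots> = avgstretch m \<phi> + (mean_dist m \<phi> \<psi> + mean_dist m \<phi> \<psi>)"
    using expectation_adjacent_pairs_fst[OF assms(1), of ?g, folded P_def]
      expectation_adjacent_pairs_snd[OF assms(1), of ?g, folded P_def]
    by (simp add: avgstretch_eq_expectation mean_dist_def flip: P_def)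
  finally show ?thesis by simp
qed

lemma avgstretch_append:
  assumes "m > 0"
  shows "avgstretch m (\<lambda>x. x @ v) = 1"
proof -
  have "(\<Sum>(x, x')\<in>adjacent_pairs m. hamming_cost (x @ v) (x' @ v)) = (\<Sum>p\<in>adjacent_pairs m. 1)"
    by (intro sum.cong) (auto simp: adjacent_pairs_def cube_def hamming_dist_append)
  then show ?thesis
    using assms by (simp add: avgstretch_eq_expectation integral_pmf_of_set adjacent_pairs_nonempty)
qed

section \<open>Tribes\<close>

definition nontribes :: "nat \<Rightarrow> nat \<Rightarrow> bool list set" where
  "nontribes w s = {x \<in> cube (s * w). \<not> tribes w s x}"

lemma tribes_append:
  assumes "u \<in> cube w"
  shows "tribes w (Suc s) (u @ v) \<longleftrightarrow> u = replicate w True \<or> tribes w s v"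
proof -
  have "(\<exists>i<Suc s. \<forall>j<w. (u @ v) ! (i * w + j))
      \<longleftrightarrow> (\<forall>j<w. (u @ v) ! j) \<or> (\<exists>i<s. \<forall>j<w. (u @ v) ! (Suc i * w + j))"
    by (subst Ex_less_Suc2) simp
  moreover have "(\<forall>j<w. (u @ v) ! j) \<longleftrightarrow> u = replicate w True"
    using assms by (auto simp: cube_def nth_append list_eq_iff_nth_eq)
  moreover have "(u @ v) ! (Suc i * w + j) = v ! (i * w + j)" for i j
    using assms by (simp add: cube_def nth_append)
  ultimately show ?thesis unfolding tribes_def by simp
qed

lemma nontribes_0 [simp]: "nontribes w 0 = {[]}"
  by (auto simp: nontribes_def tribes_def)

lemma nontribes_Suc: "nontribes w (Suc s) = (cube w - {replicate w True}) @@ nontribes w s"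
proof -
  have "nontribes w (Suc s) = {x \<in> cube w @@ cube (s * w). \<not> tribes w (Suc s) x}"
    by (simp add: nontribes_def flip: cube_add)
  also have "\<dots> = (cube w - {replicate w True}) @@ nontribes w s"
    by (auto simp: conc_def tribes_append nontribes_def)
  finally show ?thesis .
qed

lemma nontribes_subset_cube: "nontribes w s \<subseteq> cube (s * w)"
  by (auto simp: nontribes_def)

lemma finite_nontribes [simp]: "finite (nontribes w s)"
  by (rule finite_subset[OF nontribes_subset_cube]) simp

lemma replicate_in_cube [simp]: "replicate w b \<in> cube w"
  by (simp add: cube_def)

lemma card_nontribes: "real (card (nontribes w s)) = (1 - 1 / 2 ^ w) ^ s * 2 ^ (s * w)"
proof (induction s)
  case (Suc s)
  have "card (nontribes w (Suc s)) = card (cube w - {replicate w True}) * card (nontribes w s)"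
    unfolding nontribes_Suc by (rule card_conc[of _ w]) (auto simp: cube_def)
  then have "real (card (nontribes w (Suc s))) = (2 ^ w - 1) * card (nontribes w s)"
    by (simp add: card_cube of_nat_diff)
  moreover have "(2 ^ w - 1 :: real) = (1 - 1 / 2 ^ w) * 2 ^ w" by (simp add: left_diff_distrib)
  ultimately show ?case using Suc by (simp add: power_add)
qed simp

lemma card_nontribes_pos:
  assumes "w > 0"
  shows "card (nontribes w s) > 0"
proof -
  have "(1 - 1 / 2 ^ w :: real) > 0" using assms by simp
  then have "real (card (nontribes w s)) > 0" by (simp add: card_nontribes)
  then show ?thesis by simp
qed

definition overwrite_plan :: "'a \<Rightarrow> 'a set \<Rightarrow> 'a \<Rightarrow> 'a \<Rightarrow> real" where
  "overwrite_plan a B x y = (if y = a then 1 / real (card B - 1) else if y = x then 1 else 0)"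

lemma card_gt_1_if_neq_singleton:
  assumes "finite B" "a \<in> B" "B \<noteq> {a}"
  shows "card B > 1"
proof -
  have "card B \<noteq> 0" "card B \<noteq> 1" using assms by (auto simp: card_1_singleton_iff)
  then show ?thesis by linarith
qed

lemma transport_plan_overwrite:
  assumes "finite B" "a \<in> B" "B \<noteq> {a}"
  shows "transport_plan (B - {a}) (\<lambda>_. 1 + 1 / real (card B - 1)) B (\<lambda>_. 1) (overwrite_plan a B)"
proof (rule transport_planI)
  note card_B = card_gt_1_if_neq_singleton[OF assms]
  show "0 \<le> overwrite_plan a B x y" for x y
    using card_B by (simp add: overwrite_plan_def)
  show "(\<Sum>y\<in>B. overwrite_plan a B x y) = 1 + 1 / real (card B - 1)" if "x \<in> B - {a}" for x
  proof -
    have "(\<Sum>y\<in>B. overwrite_plan a B x y)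
        = 1 / real (card B - 1) + (\<Sum>y\<in>B - {a}. if y = x then 1 else 0)"
      by (simp add: sum.remove[OF assms(1,2)] overwrite_plan_def)
    then show ?thesis using that assms(1) by simp
  qed
  show "(\<Sum>x\<in>B - {a}. overwrite_plan a B x y) = 1" if "y \<in> B" for y
  proof (cases "y = a")
    case True
    then show ?thesis using card_B assms(2) by (simp add: overwrite_plan_def)
  next
    case False
    then show ?thesis using that assms(1) by (simp add: overwrite_plan_def)
  qed
qed

lemma transport_cost_overwrite:
  assumes "finite B" "a \<in> B" "B \<noteq> {a}"
    and "\<And>x. x \<in> B \<Longrightarrow> d x x = 0" "\<And>x. x \<in> B \<Longrightarrow> d x a \<le> b"
  shows "transport_cost d (B - {a}) B (overwrite_plan a B) \<le> b"
proof -
  note card_B = card_gt_1_if_neq_singleton[OF assms(1-3)]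
  have "(\<Sum>y\<in>B. overwrite_plan a B x y * d x y) = d x a / real (card B - 1)" if "x \<in> B - {a}" for x
  proof -
    have "(\<Sum>y\<in>B - {a}. overwrite_plan a B x y * d x y) = 0"
      using assms(4) that by (intro sum.neutral) (auto simp: overwrite_plan_def)
    then show ?thesis by (simp add: sum.remove[OF assms(1,2)] overwrite_plan_def)
  qed
  then have "transport_cost d (B - {a}) B (overwrite_plan a B)
      = (\<Sum>x\<in>B - {a}. d x a / real (card B - 1))"
    unfolding transport_cost_def by (intro sum.cong) auto
  also have "\<dots> \<le> (\<Sum>x\<in>B - {a}. b / real (card B - 1))"
    using assms(5) card_B by (intro sum_mono divide_right_mono) auto
  also have "\<dots> = b" using card_B assms(2) by simp
  finally show ?thesis .
qed

text \<open>Up to the constant row mass, this is the random overwriting of blocks; the normalisation gives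
  every target one unit.\<close>

primrec tribes_plan :: "nat \<Rightarrow> nat \<Rightarrow> bool list \<Rightarrow> bool list \<Rightarrow> real" where
  "tribes_plan w 0 = (\<lambda>_ _. 1)"
| "tribes_plan w (Suc s) =
     conc_plan w (overwrite_plan (replicate w True) (cube w)) (tribes_plan w s)"

lemma cube_neq_singleton:
  assumes "w > 0"
  shows "cube w \<noteq> {a}"
proof
  assume "cube w = {a}"
  then have "card (cube w) = 1" by simp
  then show False using assms by (simp add: card_cube)
qed

lemma transport_plan_overwrite_cube:
  assumes "w > 0" "a \<in> cube w"
  shows "transport_plan (cube w - {a}) (\<lambda>_. 1 + 1 / (2 ^ w - 1)) (cube w) (\<lambda>_. 1)
    (overwrite_plan a (cube w))"
  using transport_plan_overwrite[OF finite_cube assms(2) cube_neq_singleton[OF assms(1)]]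
  by (simp add: card_cube of_nat_diff)

lemma transport_plan_tribes:
  assumes "w > 0"
  shows "transport_plan (nontribes w s) (\<lambda>_. (1 + 1 / (2 ^ w - 1)) ^ s) (cube (s * w)) (\<lambda>_. 1)
    (tribes_plan w s)"
proof (induction s)
  case 0
  show ?case by (simp add: transport_plan_def)
next
  case (Suc s)
  show ?case
    using transport_plan_conc[where a = w,
        OF _ _ transport_plan_overwrite_cube[OF assms replicate_in_cube] Suc]
    by (auto simp: nontribes_Suc cube_add cubeD)
qed

lemma tribes_plan_nontribes:
  assumes "x \<in> nontribes w s" "y \<in> nontribes w s"
  shows "tribes_plan w s x y = (if x = y then 1 else 0)"
  using assms
proof (induction s arbitrary: x y)
  case (Suc s)
  obtain u v where x: "x = u @ v" "u \<in> cube w - {replicate w True}" "v \<in> nontribes w s"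
    using Suc.prems(1) unfolding nontribes_Suc by (rule concE)
  obtain u' v' where y: "y = u' @ v'" "u' \<in> cube w - {replicate w True}" "v' \<in> nontribes w s"
    using Suc.prems(2) unfolding nontribes_Suc by (rule concE)
  show ?case
    using Suc.IH[OF x(3) y(3)] x(1,2) y(1,2)
    by (auto simp: cube_def conc_plan_append overwrite_plan_def)
qed simp

lemma transport_cost_tribes:
  assumes "w > 0"
  shows "transport_cost hamming_cost (nontribes w s) (cube (s * w)) (tribes_plan w s)
    \<le> real (s * w) * 2 ^ (s * w) / 2 ^ w"
proof (induction s)
  case 0
  show ?case by (simp add: transport_cost_def)
next
  case (Suc s)
  let ?a = "replicate w True" and ?D = "nontribes w s"
  let ?K = "overwrite_plan ?a (cube w)"
  have additive: "hamming_cost (u @ v) (u' @ v') = hamming_cost u u' + hamming_cost v v'"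
    if "u \<in> cube w - {?a}" "u' \<in> cube w" "v \<in> ?D" "v' \<in> cube (s * w)" for u u' v v'
    using that nontribes_subset_cube[of w s] by (auto simp: cube_def hamming_dist_append)
  have block_cost: "transport_cost hamming_cost (cube w - {?a}) (cube w) ?K \<le> w"
    using cube_neq_singleton[OF assms] hamming_dist_le_length
    by (intro transport_cost_overwrite finite_cube replicate_in_cube) (auto simp: cube_def)
  have "transport_cost hamming_cost (nontribes w (Suc s)) (cube (Suc s * w)) (tribes_plan w (Suc s))
      = transport_cost hamming_cost (cube w - {?a}) (cube w) ?K * 2 ^ (s * w)
        + 2 ^ w * transport_cost hamming_cost ?D (cube (s * w)) (tribes_plan w s)"
    using transport_cost_conc[where a = w and d = hamming_cost,
        OF _ _ transport_plan_overwrite_cube transport_plan_tribes additive, OF _ _ assms _ assms]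
    by (auto simp: nontribes_Suc cube_add card_cube cubeD)
  also have "\<dots> \<le> w * 2 ^ (s * w) + 2 ^ w * (real (s * w) * 2 ^ (s * w) / 2 ^ w)"
    using block_cost Suc by (intro add_mono mult_right_mono mult_left_mono) simp_all
  also have "\<dots> = real (Suc s * w) * 2 ^ (Suc s * w) / 2 ^ w"
    by (simp add: power_add algebra_simps add_divide_distrib)
  finally show ?case .
qed

text \<open>The plan of \<open>transport_plan_tribes\<close> leaves one unit of mass on each point of
  \<open>nontribes w s\<close>, and only the remaining mass enters here.\<close>

lemma transport_within_nontribes_tribes:
  assumes "w > 0"
  shows "transport_within hamming_cost (real (s * w) * 2 ^ (s * w) / 2 ^ w)
    (nontribes w s) (\<lambda>_. 2 ^ (s * w) / card (nontribes w s) - 1)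
    (cube (s * w) - nontribes w s) (\<lambda>_. 1)"
proof (rule transport_withinI)
  let ?D = "nontribes w s" and ?C = "cube (s * w)" and ?P = "tribes_plan w s"
  note P = transport_plan_tribes[OF assms, of s]
  have "(1 + 1 / (2 ^ w - 1)) ^ s * real (card ?D) = 2 ^ (s * w)"
    using transport_plan_mass[OF P] by (simp add: card_cube mult.commute)
  then have row_mass: "(1 + 1 / (2 ^ w - 1)) ^ s = 2 ^ (s * w) / real (card ?D)"
    using card_nontribes_pos[OF assms, of s] by (auto simp: eq_divide_eq)
  show "transport_plan ?D (\<lambda>_. 2 ^ (s * w) / card ?D - 1) (?C - ?D) (\<lambda>_. 1) ?P"
    using P unfolding row_mass
    by (rule transport_plan_remove_diagonal[OF finite_cube nontribes_subset_cube])
      (rule tribes_plan_nontribes)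
  have "transport_cost hamming_cost ?D (?C - ?D) ?P \<le> transport_cost hamming_cost ?D ?C ?P"
    unfolding transport_cost_def using transport_planD(1)[OF P]
    by (intro sum_mono sum_mono2) auto
  also have "\<dots> \<le> real (s * w) * 2 ^ (s * w) / 2 ^ w" by (rule transport_cost_tribes[OF assms])
  finally show "transport_cost hamming_cost ?D (?C - ?D) ?P
    \<le> real (s * w) * 2 ^ (s * w) / 2 ^ w" .
qed

lemma card_superset_Int_nontribes:
  assumes "cube (s * w) - nontribes w s \<subseteq> Y" "Y \<subseteq> cube (s * w)"
  shows "real (card (Y \<inter> nontribes w s))
    = real (card Y) + real (card (nontribes w s)) - 2 ^ (s * w)"
proof -
  have "finite Y" using assms(2) by (rule finite_subset) simp
  moreover have "Y \<union> nontribes w s = cube (s * w)" using assms nontribes_subset_cube by blast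
  ultimately have "card Y + card (nontribes w s) = 2 ^ (s * w) + card (Y \<inter> nontribes w s)"
    using card_Un_Int[of Y "nontribes w s"] by (simp add: card_cube)
  from arg_cong[OF this, of real] show ?thesis by simp
qed

text \<open>Half a unit leaves every point of the cube: the tribes points keep theirs, and the rest
  goes to the tribes points, completing them to one unit, and uniformly to the additional
  points of \<open>Y\<close>.\<close>

lemma transport_within_tribes_superset:
  assumes "w > 0" and n: "n = s * w"
    and Y: "cube n - nontribes w s \<subseteq> Y" "Y \<subseteq> cube n" "2 * real (card Y) = 2 ^ n"
  shows "transport_within hamming_cost
    (1 / 2 * (real n * 2 ^ n / 2 ^ w) + real n * (real (card (nontribes w s)) - 2 ^ n / 2))
    (cube n) (\<lambda>_. 1 / 2) Y (\<lambda>_. 1)"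
proof -
  let ?D = "nontribes w s"
  define A E where "A = cube n - ?D" and "E = Y \<inter> ?D"
  have D: "?D \<subseteq> cube n" "card ?D > 0"
    using nontribes_subset_cube card_nontribes_pos[OF assms(1)] n by auto
  have card_E: "real (card E) = real (card ?D) - 2 ^ n / 2"
    using card_superset_Int_nontribes[of s w Y] Y by (simp add: E_def n)
  have "finite Y" using Y(2) by (rule finite_subset) simp
  have "A \<subseteq> cube n" "A \<subseteq> Y" "E \<subseteq> Y" using Y(1) by (auto simp: A_def E_def)
  note extend = transport_within_extend[OF _ _ _ finite_cube \<open>finite Y\<close>]
  have "transport_within hamming_cost 0 A (\<lambda>_. 1 / 2) A (\<lambda>_. 1 / 2)"
    by (rule transport_within_identity) (simp_all add: A_def)
  note keep = extend[OF this \<open>A \<subseteq> cube n\<close> \<open>A \<subseteq> Y\<close>]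
  have "transport_within hamming_cost (1 / 2 * (real n * 2 ^ n / 2 ^ w))
      ?D (\<lambda>_. 1 / 2 * (2 ^ n / card ?D - 1)) A (\<lambda>_. 1 / 2 * 1)"
    unfolding A_def n
    by (rule transport_within_scale[OF transport_within_nontribes_tribes[OF assms(1)]]) simp
  note complete = extend[OF this D(1) \<open>A \<subseteq> Y\<close>]
  have "transport_within hamming_cost (real n * card E) ?D (\<lambda>_. card E / card ?D) E (\<lambda>_. 1)"
    using D by (intro transport_within_uniform_cube) auto
  note spread = extend[OF this D(1) \<open>E \<subseteq> Y\<close>]
  show ?thesis
    using transport_within_add[OF keep transport_within_add[OF complete spread]]
    unfolding card_E add_0_left
  proof (rule iffD1[OF transport_within_cong, rotated -1])
    fix x assume "x \<in> cube n"
    then show "(if x \<in> A then 1 / 2 else 0) + ((if x \<in> ?D then 1 / 2 * (2 ^ n / card ?D - 1) else 0)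
        + (if x \<in> ?D then (card ?D - 2 ^ n / 2) / card ?D else 0)) = 1 / 2"
      using D(2) by (auto simp: A_def diff_divide_distrib right_diff_distrib)
  next
    fix y assume "y \<in> Y"
    then show "(if y \<in> A then 1 / 2 else 0) + ((if y \<in> A then 1 / 2 * 1 else 0)
        + (if y \<in> E then 1 else 0)) = (1 :: real)"
      using Y(2) by (cases "y \<in> ?D") (auto simp: A_def E_def)
  qed
qed

lemma tribes_superset_bijection:
  assumes "w > 0" "n = s * w" "n > 0"
    and Y: "{x \<in> cube n. tribes w s x} \<subseteq> Y" "Y \<subseteq> cube n" "card Y = 2 ^ (n - 1)"
  shows "\<exists>\<phi>. bij_betw \<phi> (cube (n - 1)) Y \<and>
    mean_dist (n - 1) (\<lambda>x. x @ [False]) \<phi>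
      \<le> n / 2 ^ w + 2 * real n * ((1 - 1 / 2 ^ w) ^ s - 1 / 2) + 1"
proof -
  obtain m where m: "n = Suc m" using assms(3) by (cases n) auto
  let ?c = "1 / 2 * (real n * 2 ^ n / 2 ^ w) + real n * (real (card (nontribes w s)) - 2 ^ n / 2)"
  have "cube n - nontribes w s \<subseteq> Y" using Y(1) assms(2) by (auto simp: nontribes_def)
  moreover have "2 * real (card Y) = 2 ^ n" using Y(3) m by simp
  ultimately have "transport_within hamming_cost ?c (cube n) (\<lambda>_. 1 / 2) Y (\<lambda>_. 1)"
    using Y(2) by (intro transport_within_tribes_superset[OF assms(1,2)])
  then have "transport_within (\<lambda>x. hamming_cost (x @ [False])) (?c + 2 ^ m)
      (cube m) (\<lambda>_. 1) Y (\<lambda>_. 1)"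
    unfolding m by (rule transport_within_merge_last)
  then obtain \<phi> where \<phi>: "bij_betw \<phi> (cube m) Y"
    and "1 * (\<Sum>x\<in>cube m. hamming_cost (x @ [False]) (\<phi> x)) \<le> ?c + 2 ^ m"
    using transport_within_imp_bij[of "cube m" Y 1] finite_subset[OF Y(2)] by auto
  then have "mean_dist m (\<lambda>x. x @ [False]) \<phi> \<le> (?c + 2 ^ m) / 2 ^ m"
    unfolding mean_dist_eq_sum by (intro divide_right_mono) auto
  also have "\<dots> = n / 2 ^ w + 2 * real n * ((1 - 1 / 2 ^ w) ^ s - 1 / 2) + 1"
    unfolding card_nontribes assms(2)[symmetric] by (simp add: m field_simps)
  finally show ?thesis using \<phi> m by auto
qed

section \<open>The threshold\<close>

lemma tribes_threshold_bracket:
  assumes "tribes_threshold w s"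
  shows "(1 - 1 / 2 ^ w) ^ s \<ge> (1 / 2 :: real)" and "(1 - 1 / 2 ^ w) ^ Suc s < (1 / 2 :: real)"
proof -
  show "(1 - 1 / 2 ^ w) ^ s \<ge> (1 / 2 :: real)"
    using assms by (simp add: tribes_threshold_def)
  have "\<not> 1 - (1 - 1 / 2 ^ w) ^ Suc s \<le> (1 / 2 :: real)"
    using assms Suc_n_not_le_n unfolding tribes_threshold_def by blast
  then show "(1 - 1 / 2 ^ w) ^ Suc s < (1 / 2 :: real)" by linarith
qed

lemma mult_le_1_if_power_ge_half:
  fixes p :: real
  assumes "p \<le> 1" "(1 - p) ^ s \<ge> 1 / 2"
  shows "s * p \<le> 1"
proof -
  have "1 / 2 \<le> (1 - p) ^ s" by fact
  also have "\<dots> \<le> exp (- p) ^ s"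
    using assms(1) exp_ge_add_one_self[of "- p"] by (intro power_mono) auto
  also have "\<dots> = exp (- (s * p))" by (simp add: exp_of_nat_mult[symmetric])
  finally have "exp (s * p) \<le> 2" by (simp add: exp_minus field_simps)
  also have "(2::real) \<le> exp 1" using exp_ge_add_one_self[of 1] by simp
  finally show ?thesis by simp
qed

lemma tribes_threshold_power_le:
  assumes "tribes_threshold w s"
  shows "(1 - 1 / 2 ^ w) ^ s \<le> (1 / 2 + 1 / 2 ^ w :: real)"
proof -
  define p :: real where "p = 1 / 2 ^ w"
  have "0 \<le> p" "p \<le> 1" by (auto simp: p_def)
  then have "p * (1 - p) ^ s \<le> p" by (intro mult_left_le power_le_one) auto
  moreover have "(1 - p) ^ s - p * (1 - p) ^ s < 1 / 2"
    using tribes_threshold_bracket(2)[OF assms] by (simp add: p_def algebra_simps)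
  ultimately show ?thesis by (simp add: p_def)
qed

lemma tribes_threshold_width_le:
  assumes "w > 0" "tribes_threshold w s"
  shows "2 ^ w \<le> 2 * s"
proof -
  have "1 - real (Suc s) / 2 ^ w \<le> (1 - 1 / 2 ^ w) ^ Suc s"
    using Bernoulli_inequality[of "- (1 / 2 ^ w)" "Suc s"] by (simp del: power_Suc of_nat_Suc)
  also have "\<dots> < 1 / 2" by (rule tribes_threshold_bracket(2)[OF assms(2)])
  finally have "2 ^ w < 2 * real (Suc s)" by (simp add: field_simps)
  then have "2 ^ w < 2 * Suc s"
    using of_nat_less_iff[of "2 ^ w" "2 * Suc s", where 'a = real] by simp
  moreover have "even (2 ^ w :: nat)" using assms(1) by simp
  ultimately show ?thesis by presburger
qed

lemma tribes_threshold_width_le_log: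
  fixes n w s :: nat
  assumes "w > 0" "tribes_threshold w s" "n = s * w" "n > 1"
  shows "w \<le> 2 * log 2 n"
proof -
  have "2 ^ (w - 1) \<le> s" using tribes_threshold_width_le[OF assms(1,2)] assms(1) by (cases w) auto
  also have "s \<le> n" using assms(1,3) by simp
  finally have "real (w - 1) \<le> log 2 n" by (rule le_log2_of_power)
  moreover have "1 \<le> log 2 n" using assms(4) by (simp add: le_log_iff)
  ultimately show ?thesis using assms(1) by (simp add: of_nat_diff)
qed

lemma tribes_threshold_bijection:
  assumes "w > 0" "tribes_threshold w s" "n = s * w" "n > 0"
    and Y: "{x \<in> cube n. tribes w s x} \<subseteq> Y" "Y \<subseteq> cube n" "card Y = 2 ^ (n - 1)"
  shows "\<exists>\<phi>. bij_betw \<phi> (cube (n - 1)) Y \<and> mean_dist (n - 1) (\<lambda>x. x @ [False]) \<phi> \<le> 4 * real w"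
proof -
  obtain \<phi> where \<phi>: "bij_betw \<phi> (cube (n - 1)) Y"
    and dist: "mean_dist (n - 1) (\<lambda>x. x @ [False]) \<phi>
      \<le> n / 2 ^ w + 2 * real n * ((1 - 1 / 2 ^ w) ^ s - 1 / 2) + 1"
    using tribes_superset_bijection[OF assms(1,3,4) Y] by blast
  note dist
  also have "\<dots> \<le> n / 2 ^ w + 2 * real n * (1 / 2 ^ w) + 1"
    using tribes_threshold_power_le[OF assms(2)] by (intro add_mono mult_left_mono) auto
  also have "\<dots> = 3 * real w * (s * (1 / 2 ^ w)) + 1" by (simp add: assms(3))
  also have "\<dots> \<le> 3 * real w * 1 + 1"
    using mult_le_1_if_power_ge_half[OF _ tribes_threshold_bracket(1)[OF assms(2)]]
    by (intro add_mono mult_left_mono) auto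
  also have "\<dots> \<le> 4 * real w" using assms(1) by simp
  finally show ?thesis using \<phi> by blast
qed

theorem theorem4:
  shows "\<exists>C::real. C > 0 \<and>
    (\<forall>(w::nat) (s::nat) (n::nat) (A::bool list set) (Astar::bool list set).
       w > 0 \<longrightarrow> tribes_threshold w s \<longrightarrow> n = s * w \<longrightarrow> n > 1 \<longrightarrow>
       A = {x \<in> cube n. tribes w s x} \<longrightarrow>
       A \<subseteq> Astar \<longrightarrow> Astar \<subseteq> cube n \<longrightarrow> card Astar = 2 ^ (n - 1) \<longrightarrow>
       (\<exists>\<phi>. bij_betw \<phi> (cube (n - 1)) Astar \<and>
            measure_pmf.expectation (pmf_of_set (cube (n - 1)))
              (\<lambda>x. real (hamming_dist (x @ [False]) (\<phi> x))) \<le> C * log 2 (real n) \<and>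
            avgstretch (n - 1) \<phi> \<le> 2 * C * log 2 (real n) + 1))"
proof (intro exI[of _ 8] conjI allI impI)
  fix w s n :: nat and A Astar :: "bool list set"
  assume w: "w > 0" "tribes_threshold w s" and n: "n = s * w" "n > 1"
    and Astar: "A = {x \<in> cube n. tribes w s x}" "A \<subseteq> Astar" "Astar \<subseteq> cube n"
      "card Astar = 2 ^ (n - 1)"
  obtain \<phi> where \<phi>: "bij_betw \<phi> (cube (n - 1)) Astar"
    and "mean_dist (n - 1) (\<lambda>x. x @ [False]) \<phi> \<le> 4 * real w"
    using tribes_threshold_bijection[OF w n(1) _ _ Astar(3,4)] Astar(1,2) n(2) by auto
  then have dist: "mean_dist (n - 1) (\<lambda>x. x @ [False]) \<phi> \<le> 8 * log 2 n"
    using tribes_threshold_width_le_log[OF w n] by simp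
  have "\<phi> \<in> cube (n - 1) \<rightarrow> cube n" using \<phi> Astar(3) by (auto simp: bij_betw_def)
  moreover have "(\<lambda>x. x @ [False]) \<in> cube (n - 1) \<rightarrow> cube n" using n(2) by (auto simp: cube_def)
  ultimately have "avgstretch (n - 1) \<phi> \<le> 1 + 2 * mean_dist (n - 1) (\<lambda>x. x @ [False]) \<phi>"
    using avgstretch_perturb[of "n - 1" "\<lambda>x. x @ [False]" n \<phi>]
      avgstretch_append[of "n - 1"] n(2) by simp
  then show "\<exists>\<phi>. bij_betw \<phi> (cube (n - 1)) Astar \<and>
      measure_pmf.expectation (pmf_of_set (cube (n - 1)))
        (\<lambda>x. real (hamming_dist (x @ [False]) (\<phi> x))) \<le> 8 * log 2 (real n) \<and>
      avgstretch (n - 1) \<phi> \<le> 2 * 8 * log 2 (real n) + 1"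
    using \<phi> dist by (auto simp: mean_dist_def)
qed simp

end
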